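(* Assume the dichotomy $( * )$ for p-ideals. Then every weakly distributive ccc complete Boolean algebra carries a strictly positive Maharam submeasure.
   Context: An ideal $\mathcal{I}$ of sets (a family closed under subsets and finite unions) is a p-ideal if for every sequence $\langle A_n : n \in \omega\rangle$ of sets in $\mathcal{I}$ there is $A \in \mathcal{I}$ such that $A_n - A$ is finite for every $n \in \omega$. $( * )$ (Dichotomy for p-ideals) is the statement: for every infinite set $S$ and every p-ideal $\mathcal{I} \subset [S]^{\le \omega}$ (countable subsets of $S$), either (i) there is an uncountable $Y \subset S$ such that $[Y]^{\le\omega} \subset \mathcal{I}$, or (ii) there are sets $S_n$, $n \in \omega$, with $\bigcup_n S_n = S$ such that $S_n \cap I$ is finite for every $n \in \omega$ and every $I \in \mathcal{I}$. A Boolean algebra is ccc if every antichain (set of pairwise disjoint nonzero elements) is countable. A complete Boolean algebra $B$ is weakly distributive if for every sequence $\langle P_n : n \in \omega\rangle$ of countable maximal antichains there is a maximal antichain $Q$ such that each $q \in Q$ meets (has nonzero meet with) only finitely many elements of each $P_n$. A submeasure on $B$ is a nonnegative real valued function $\mu$ on $B$ with $\mu(\mathbf{0}) = 0$; $\mu(a) \le \mu(b)$ whenever $a \le b$; and $\mu(a \vee b) \le \mu(a) + \mu(b)$. It is strictly positive if $\mu(a) = 0$ only for $a = \mathbf{0}$. It is a Maharam submeasure if it is continuous: $\lim_n \mu(a_n) = 0$ for every decreasing sequence $\langle a_n : n \in \omega\rangle$ with $\bigwedge_n a_n = \mathbf{0}$. *)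

theory Defs
  imports "HOL-Analysis.Analysis"
begin

definition countable_subsets :: "'a set \<Rightarrow> 'a set set" where
  "countable_subsets S = {A. A \<subseteq> S \<and> countable A}"

definition set_ideal :: "'a set set \<Rightarrow> bool" where
  "set_ideal \<I> \<longleftrightarrow>
     (\<forall>A\<in>\<I>. \<forall>B\<subseteq>A. B \<in> \<I>) \<and>
     (\<forall>\<F>\<subseteq>\<I>. finite \<F> \<longrightarrow> \<Union>\<F> \<in> \<I>)"

definition p_ideal :: "'a set set \<Rightarrow> bool" where
  "p_ideal \<I> \<longleftrightarrow>
     set_ideal \<I> \<and>
     (\<forall>A :: nat \<Rightarrow> 'a set. (\<forall>n. A n \<in> \<I>) \<longrightarrow> (\<exists>B\<in>\<I>. \<forall>n. finite (A n - B)))"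

(* The set-theoretic dichotomy quantifies over all infinite sets S. A HOL formula cannot
   quantify over types, so S ranges over the infinite sets of elements of the given type. *)

definition p_ideal_dichotomy :: "'a itself \<Rightarrow> bool" where
  "p_ideal_dichotomy (T :: 'a itself) \<longleftrightarrow>
     (\<forall>S :: 'a set. infinite S \<longrightarrow>
       (\<forall>\<I>. p_ideal \<I> \<and> \<I> \<subseteq> countable_subsets S \<longrightarrow>
          (\<exists>Y\<subseteq>S. uncountable Y \<and> countable_subsets Y \<subseteq> \<I>) \<or>
          (\<exists>X :: nat \<Rightarrow> 'a set. (\<Union>n. X n) = S \<and> (\<forall>n. \<forall>I\<in>\<I>. finite (X n \<inter> I)))))"

(* Complete Boolean algebras are types of sort {boolean_algebra, complete_lattice}. The library
   class complete_boolean_algebra must not be used here: it includes complete_distrib_lattice,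
   that is, complete distributivity, which forces the algebra to be atomic. *)

definition ba_antichain :: "'b::boolean_algebra set \<Rightarrow> bool" where
  "ba_antichain A \<longleftrightarrow> bot \<notin> A \<and> pairwise (\<lambda>a b. inf a b = bot) A"

definition maximal_ba_antichain :: "'b::boolean_algebra set \<Rightarrow> bool" where
  "maximal_ba_antichain A \<longleftrightarrow>
     ba_antichain A \<and> (\<forall>A'. ba_antichain A' \<and> A \<subseteq> A' \<longrightarrow> A' = A)"

definition ccc :: "'b::boolean_algebra itself \<Rightarrow> bool" where
  "ccc (T :: 'b itself) \<longleftrightarrow> (\<forall>A :: 'b set. ba_antichain A \<longrightarrow> countable A)"

definition weakly_distributive :: "'b::{boolean_algebra,complete_lattice} itself \<Rightarrow> bool" where
  "weakly_distributive (T :: 'b itself) \<longleftrightarrow>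
     (\<forall>P :: nat \<Rightarrow> 'b set. (\<forall>n. countable (P n) \<and> maximal_ba_antichain (P n)) \<longrightarrow>
       (\<exists>Q. maximal_ba_antichain Q \<and>
            (\<forall>q\<in>Q. \<forall>n. finite {p \<in> P n. inf q p \<noteq> bot})))"

definition submeasure :: "('b::boolean_algebra \<Rightarrow> real) \<Rightarrow> bool" where
  "submeasure \<mu> \<longleftrightarrow>
     (\<forall>a. 0 \<le> \<mu> a) \<and> \<mu> bot = 0 \<and>
     (\<forall>a b. a \<le> b \<longrightarrow> \<mu> a \<le> \<mu> b) \<and>
     (\<forall>a b. \<mu> (sup a b) \<le> \<mu> a + \<mu> b)"

definition strictly_positive :: "('b::boolean_algebra \<Rightarrow> real) \<Rightarrow> bool" where
  "strictly_positive \<mu> \<longleftrightarrow> (\<forall>a. \<mu> a = 0 \<longrightarrow> a = bot)"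

definition maharam_submeasure :: "('b::{boolean_algebra,complete_lattice} \<Rightarrow> real) \<Rightarrow> bool" where
  "maharam_submeasure \<mu> \<longleftrightarrow>
     submeasure \<mu> \<and>
     (\<forall>a :: nat \<Rightarrow> 'b. decseq a \<and> (INF n. a n) = bot \<longrightarrow> (\<lambda>n. \<mu> (a n)) \<longlonglongrightarrow> 0)"

end

theory Submission
  imports Defs
begin

text \<open>
  Weak distributivity yields a diagonal principle for sequences converging to zero, so the
  countable sets of nonzero elements that converge to zero form a p-ideal. The first alternative
  of the dichotomy contradicts ccc: an uncountable set of nonzero elements contains infinitely
  many disjoint countable subsets whose joins lie above the same nonzero element. The second
  alternative gives open neighbourhoods U(n) of zero that decrease to {0}. Then for every
  neighbourhood G there is a neighbourhood V whose pairwise joins lie in G: otherwise one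
  chooses pairs x(n), y(n) with join outside G so that x(k) \<squnion> ... \<squnion> x(m) \<in> U(k) for all
  k \<le> m, and likewise for y; diagonalizing over these finite joins shows that both sequences
  converge to zero, a contradiction. Hence zero has a sequence of neighbourhoods that shrinks
  under triple joins, and Frink's metrization argument turns it into the submeasure.
\<close>

section \<open>Null sequences and the diagonal principle from weak distributivity\<close>

text \<open>
  For a complete algebra, \<open>null_seq x\<close> says that the limes superior of \<open>x\<close> is zero; this density
  form avoids infinite joins.
\<close>

definition null_seq :: "(nat \<Rightarrow> 'b::boolean_algebra) \<Rightarrow> bool" where
  "null_seq x \<longleftrightarrow> (\<forall>b. b \<noteq> bot \<longrightarrow> (\<exists>q\<le>b. q \<noteq> bot \<and> (\<exists>N. \<forall>n\<ge>N. inf q (x n) = bot)))"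

text \<open>For an injective enumeration of a countably infinite set this agrees with
  \<open>null_seq\<close>; it spares the choice of an enumeration, and finite sets qualify
  automatically.\<close>

definition null_set :: "'b::boolean_algebra set \<Rightarrow> bool" where
  "null_set A \<longleftrightarrow> (\<forall>b. b \<noteq> bot \<longrightarrow> (\<exists>q\<le>b. q \<noteq> bot \<and> finite {a\<in>A. inf q a \<noteq> bot}))"

lemma inf_bot_mono: "inf r x = bot \<Longrightarrow> q \<le> r \<Longrightarrow> y \<le> x \<Longrightarrow> inf q y = (bot::'b::boolean_algebra)"
  by (metis bot.extremum_uniqueI inf_mono)

text \<open>Each member of the antichain \<open>Q\<close> given by weak distributivity meets only
  finitely many pieces of a row, so it lies below some level of that row. By ccc \<open>Q\<close> is
  countable, so a single \<open>f\<close> eventually dominates the levels needed by all its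
  members.\<close>

lemma weakly_distributive_diagonal:
  fixes D :: "nat \<Rightarrow> nat \<Rightarrow> 'b::{boolean_algebra,complete_lattice}"
  assumes wd: "weakly_distributive TYPE('b)" and "ccc TYPE('b)"
    and inc: "\<And>n. incseq (D n)"
    and dense: "\<And>n r. r \<noteq> bot \<Longrightarrow> \<exists>k. inf r (D n k) \<noteq> bot"
  shows "\<exists>f :: nat \<Rightarrow> nat. \<forall>b. b \<noteq> bot \<longrightarrow>
           (\<exists>q\<le>b. q \<noteq> bot \<and> (\<exists>N. \<forall>n\<ge>N. q \<le> D n (f n)))"
proof -
  \<comment> \<open>Disjointifying each row of \<open>D\<close> gives the maximal antichains for weak distributivity.\<close>
  define p where "p n k = (if k = 0 then D n 0 else inf (D n k) (- D n (k-1)))" for n k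
  have p_le: "p n k \<le> D n k" for n k by (simp add: p_def)
  have p_disj: "inf (p n j) (p n k) = bot" if "j < k" for n j k
  proof -
    have "p n j \<le> D n (k-1)"
      by (rule order_trans[OF p_le incseqD[OF inc]]) (use that in simp)
    moreover have "p n k \<le> - D n (k-1)" using that by (simp add: p_def)
    ultimately show ?thesis by (meson inf_bot_mono inf_compl_bot)
  qed
  have p_meet: "\<exists>k. inf r (p n k) \<noteq> bot \<and> (\<forall>j. inf r (D n j) \<noteq> bot \<longrightarrow> k \<le> j) \<and> inf r (D n k) \<noteq> bot"
    if r: "r \<noteq> bot" for r n
  proof -
    \<comment> \<open>At the first level that meets \<open>r\<close>, whatever meets
      \<open>r\<close> is new at that level, hence belongs to \<open>p n k\<close>.\<close>
    define k where "k = (LEAST k. inf r (D n k) \<noteq> bot)"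
    have k: "inf r (D n k) \<noteq> bot" unfolding k_def by (rule LeastI_ex[OF dense[OF r]])
    have least: "k \<le> j" if "inf r (D n j) \<noteq> bot" for j
      unfolding k_def by (rule Least_le) (rule that)
    have "inf r (p n k) \<noteq> bot"
    proof (cases "k = 0")
      case True then show ?thesis using k by (simp add: p_def)
    next
      case False
      then have "inf r (D n (k-1)) = bot" using least[of "k-1"] by fastforce
      then have "r \<le> - D n (k-1)" by (simp add: inf_shunt)
      then have "inf r (- D n (k-1)) = r" by (rule inf.absorb1)
      then have "inf r (inf (- D n (k-1)) (D n k)) = inf r (D n k)" by (simp only: inf.assoc[symmetric])
      then have "inf r (p n k) = inf r (D n k)"
        using False by (simp add: p_def inf.commute)
      then show ?thesis using k by simp
    qed
    then show ?thesis using k least by blast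
  qed
  define P where "P n = range (p n) - {bot}" for n
  have anti: "ba_antichain (P n)" for n
    unfolding ba_antichain_def pairwise_def P_def
    using p_disj by auto (metis inf.commute nat_neq_iff)
  have "maximal_ba_antichain (P n)" for n
    unfolding maximal_ba_antichain_def
  proof (intro conjI allI impI anti)
    fix A' assume A': "ba_antichain A' \<and> P n \<subseteq> A'"
    have "a \<in> P n" if "a \<in> A'" for a
    proof (rule ccontr)
      assume "a \<notin> P n"
      have "a \<noteq> bot" using A' that by (auto simp: ba_antichain_def)
      then obtain k where k: "inf a (p n k) \<noteq> bot" using p_meet by blast
      then have "p n k \<in> P n" unfolding P_def by auto
      then have "p n k \<in> A'" "a \<noteq> p n k" using A' \<open>a \<notin> P n\<close> by auto
      then show False using A' that k by (auto simp: ba_antichain_def pairwise_def)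
    qed
    then show "A' = P n" using A' by blast
  qed
  then have "\<forall>n. countable (P n) \<and> maximal_ba_antichain (P n)"
    by (simp add: P_def)
  then obtain Q where Q: "maximal_ba_antichain Q"
    and fin: "\<And>q n. q \<in> Q \<Longrightarrow> finite {p \<in> P n. inf q p \<noteq> bot}"
    using wd unfolding weakly_distributive_def by meson
  have "countable Q"
    using Q \<open>ccc TYPE('b)\<close> by (auto simp: maximal_ba_antichain_def ccc_def)
  have Q_le: "\<exists>k. q \<le> D n k" if "q \<in> Q" for q n
  proof -
    have "inj_on (p n) {k. inf q (p n k) \<noteq> bot}"
    proof (rule inj_onI)
      fix j k assume "j \<in> {k. inf q (p n k) \<noteq> bot}" and eq: "p n j = p n k"
      then have "p n j \<noteq> bot" by auto
      then show "j = k" using p_disj[of j k n] p_disj[of k j n] eq by (cases j k rule: linorder_cases) auto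
    qed
    moreover have "p n ` {k. inf q (p n k) \<noteq> bot} \<subseteq> {p \<in> P n. inf q p \<noteq> bot}"
      by (auto simp: P_def)
    ultimately have "finite {k. inf q (p n k) \<noteq> bot}"
      using fin[OF that, of n] by (meson finite_subset inj_on_finite)
    then obtain K where K: "\<And>k. inf q (p n k) \<noteq> bot \<Longrightarrow> k \<le> K"
      by (meson finite_nat_set_iff_bounded_le mem_Collect_eq)
    \<comment> \<open>A nonzero part of \<open>q\<close> outside \<open>D n K\<close> would meet
      some piece with index at most \<open>K\<close>, together with its level, which lies below
      \<open>D n K\<close>.\<close>
    have "inf q (- D n K) = bot"
    proof (rule ccontr)
      assume "inf q (- D n K) \<noteq> bot"
      then obtain k where k: "inf (inf q (- D n K)) (p n k) \<noteq> bot" 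
        "inf (inf q (- D n K)) (D n k) \<noteq> bot"
        using p_meet by meson
      then have "inf q (p n k) \<noteq> bot" by (metis inf.commute inf.left_commute inf_bot_right)
      then have "D n k \<le> D n K" using K inc by (simp add: incseqD)
      then have "inf (- D n K) (D n k) = bot" by (metis inf.commute inf_shunt double_compl)
      then show False using k(2) by (simp add: inf.assoc)
    qed
    then show ?thesis by (auto simp: inf_shunt)
  qed
  then obtain K where K: "\<And>q n. q \<in> Q \<Longrightarrow> q \<le> D n (K q n)" by metis
  \<comment> \<open>The i-th member of \<open>Q\<close> enters the maximum as soon as n >= i, so
    \<open>f\<close> dominates its levels from there on.\<close>
  define f where "f n = Max ((\<lambda>i. K (from_nat_into Q i) n) ` {..n})" for n
  show ?thesis
  proof (intro exI[of _ f] allI impI)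
    fix b :: 'b assume b: "b \<noteq> bot"
    obtain q where q: "q \<in> Q" "inf q b \<noteq> bot"
    proof (rule ccontr)
      assume none: "\<not> thesis"
      with that have nb: "\<And>q. q \<in> Q \<Longrightarrow> inf q b = bot" by blast
      then have "ba_antichain (insert b Q)"
        using Q b unfolding maximal_ba_antichain_def ba_antichain_def
        by (auto simp: pairwise_insert inf.commute)
      then have "b \<in> Q" using Q unfolding maximal_ba_antichain_def by blast
      then show False using nb b by fastforce
    qed
    then obtain i where i: "from_nat_into Q i = q"
      using \<open>countable Q\<close> from_nat_into_to_nat_on by meson
    have "q \<le> D n (f n)" if "n \<ge> i" for n
    proof -
      have "K q n \<le> f n" unfolding f_def using that i by (intro Max_ge) auto
      then show ?thesis using K[OF q(1), of n] inc by (meson incseqD order_trans)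
    qed
    then show "\<exists>q\<le>b. q \<noteq> bot \<and> (\<exists>N. \<forall>n\<ge>N. q \<le> D n (f n))"
      using q by (intro exI[of _ "inf q b"]) (auto intro: le_infI1)
  qed
qed

lemma null_seq_subseq:
  assumes "null_seq x" "strict_mono r" shows "null_seq (x \<circ> r)"
  unfolding null_seq_def
proof (intro allI impI)
  fix b :: 'a assume "b \<noteq> bot"
  then obtain q N where "q\<le>b" "q \<noteq> bot" "\<forall>n\<ge>N. inf q (x n) = bot"
    using assms(1) unfolding null_seq_def by meson
  then show "\<exists>q\<le>b. q \<noteq> bot \<and> (\<exists>N. \<forall>n\<ge>N. inf q ((x \<circ> r) n) = bot)"
    using seq_suble[OF assms(2)] by (intro exI[of _ q]) (auto intro!: exI[of _ N] intro: order_trans)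
qed

lemma null_seq_mono:
  assumes "null_seq x" "\<And>n. y n \<le> x n" shows "null_seq y"
  using assms unfolding null_seq_def by (meson inf_bot_mono order_refl)

lemma null_seq_bot: "null_seq (\<lambda>_. bot)"
  unfolding null_seq_def by auto

lemma null_seq_sup:
  assumes "null_seq x" "null_seq y" shows "null_seq (\<lambda>n. sup (x n) (y n))"
  unfolding null_seq_def
proof (intro allI impI)
  fix b :: 'a assume "b \<noteq> bot"
  then obtain q N where q: "q\<le>b" "q \<noteq> bot" "\<forall>n\<ge>N. inf q (x n) = bot"
    using assms(1) unfolding null_seq_def by meson
  then obtain q' N' where q': "q'\<le>q" "q' \<noteq> bot" "\<forall>n\<ge>N'. inf q' (y n) = bot"
    using assms(2) unfolding null_seq_def by meson
  have "\<forall>n\<ge>max N N'. inf q' (sup (x n) (y n)) = bot"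
    using q q' by (metis inf_bot_mono inf_sup_distrib1 max.bounded_iff order_refl sup_bot_left)
  then show "\<exists>q\<le>b. q \<noteq> bot \<and> (\<exists>N. \<forall>n\<ge>N. inf q (sup (x n) (y n)) = bot)"
    using q q' by (meson order_trans)
qed

text \<open>The complements of the tail joins of each row increase, and nullness of the row makes
  them dense, so the diagonal principle applies to them.\<close>

lemma null_seq_diagonal:
  fixes v :: "nat \<Rightarrow> nat \<Rightarrow> 'b::{boolean_algebra,complete_lattice}"
  assumes "weakly_distributive TYPE('b)" "ccc TYPE('b)" and v: "\<And>n. null_seq (v n)"
  shows "\<exists>f. null_seq (\<lambda>n. v n (f n))"
proof -
  define D where "D n k = - (SUP j\<in>{k..}. v n j)" for n k
  have inc: "incseq (D n)" for n
    unfolding D_def by (intro monoI) (simp, rule SUP_subset_mono, auto)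
  have dense: "\<exists>k. inf r (D n k) \<noteq> bot" if r: "r \<noteq> bot" for n r
  proof -
    obtain q N where q: "q\<le>r" "q \<noteq> bot" "\<forall>j\<ge>N. inf q (v n j) = bot"
      using v[of n] r unfolding null_seq_def by meson
    then have "(SUP j\<in>{N..}. v n j) \<le> - q"
      by (intro SUP_least) (metis atLeast_iff inf.commute inf_shunt)
    then have "q \<le> D n N" unfolding D_def by (simp add: compl_le_swap1)
    then have "q \<le> inf r (D n N)" using q by simp
    then show ?thesis using q by (metis bot.extremum_uniqueI)
  qed
  obtain f where f: "\<And>b. b \<noteq> bot \<Longrightarrow> \<exists>q\<le>b. q \<noteq> bot \<and> (\<exists>N. \<forall>n\<ge>N. q \<le> D n (f n))"
    using weakly_distributive_diagonal[where D = D, OF assms(1,2) inc dense] by blast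
  have "D n k \<le> - v n k" for n k unfolding D_def by (simp add: SUP_upper)
  then have "null_seq (\<lambda>n. v n (f n))"
    unfolding null_seq_def inf_shunt using f by (meson order_trans)
  then show ?thesis by blast
qed

section \<open>The p-ideal of countable null sets\<close>

lemma null_set_subset:
  assumes "null_set A" "B \<subseteq> A" shows "null_set B"
  unfolding null_set_def
proof (intro allI impI)
  fix b :: 'a assume "b \<noteq> bot"
  then obtain q where q: "q\<le>b" "q \<noteq> bot" "finite {a\<in>A. inf q a \<noteq> bot}"
    using assms(1) unfolding null_set_def by meson
  have "finite {a\<in>B. inf q a \<noteq> bot}"
    by (rule finite_subset[OF _ q(3)]) (use assms(2) in auto)
  then show "\<exists>q\<le>b. q \<noteq> bot \<and> finite {a\<in>B. inf q a \<noteq> bot}" using q by blast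
qed

lemma null_set_Un:
  assumes "null_set A" "null_set B" shows "null_set (A \<union> B)"
  unfolding null_set_def
proof (intro allI impI)
  fix b :: 'a assume "b \<noteq> bot"
  then obtain q where q: "q\<le>b" "q \<noteq> bot" "finite {a\<in>A. inf q a \<noteq> bot}"
    using assms(1) unfolding null_set_def by meson
  then obtain q' where q': "q'\<le>q" "q' \<noteq> bot" "finite {a\<in>B. inf q' a \<noteq> bot}"
    using assms(2) unfolding null_set_def by meson
  have "{a \<in> A \<union> B. inf q' a \<noteq> bot} \<subseteq> {a\<in>A. inf q a \<noteq> bot} \<union> {a\<in>B. inf q' a \<noteq> bot}"
    using q'(1) by (auto dest: inf_bot_mono[OF _ _ order_refl])
  then have "finite {a \<in> A \<union> B. inf q' a \<noteq> bot}" using q q' by (meson finite_Un finite_subset)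
  then show "\<exists>q\<le>b. q \<noteq> bot \<and> finite {a \<in> A \<union> B. inf q a \<noteq> bot}" using q q' by (meson order_trans)
qed

lemma null_set_Union: "finite \<F> \<Longrightarrow> (\<And>A. A \<in> \<F> \<Longrightarrow> null_set A) \<Longrightarrow> null_set (\<Union>\<F>)"
proof (induction rule: finite_induct)
  case empty show ?case by (auto simp: null_set_def)
next
  case (insert A \<F>) then show ?case by (simp add: null_set_Un)
qed

text \<open>For the p-property, a finite initial part is removed from each \<open>A n\<close>, and
  the union of the remaining tails is the required set. The diagonal principle, applied to the
  complements of the joins of these tails, tells how much to remove.\<close>

lemma p_ideal_null_sets:
  fixes S :: "'b::{boolean_algebra,complete_lattice} set"
  assumes "weakly_distributive TYPE('b)" "ccc TYPE('b)"
  shows "p_ideal {A \<in> countable_subsets S. null_set A}"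
  unfolding p_ideal_def
proof (intro conjI allI impI)
  show "set_ideal {A \<in> countable_subsets S. null_set A}"
    unfolding set_ideal_def countable_subsets_def
  proof (intro conjI ballI allI impI, goal_cases)
    case (1 A B) then show ?case by (auto intro: null_set_subset countable_subset)
  next
    case (2 \<F>)
    have "null_set (\<Union>\<F>)" using 2 by (intro null_set_Union) auto
    moreover have "countable (\<Union>\<F>)"
      using 2 countable_UN[of \<F> "\<lambda>x. x"] by (auto intro: countable_finite)
    ultimately show ?case using 2 by auto
  qed
next
  fix A :: "nat \<Rightarrow> 'b set" assume "\<forall>n. A n \<in> {A \<in> countable_subsets S. null_set A}"
  then have A: "A n \<subseteq> S" "countable (A n)" "null_set (A n)" for n by (auto simp: countable_subsets_def)
  define T where "T n k = {a \<in> A n. k \<le> to_nat_on (A n) a}" for n k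
  have finA: "finite (A n - T n k)" for n k
  proof -
    have "inj_on (to_nat_on (A n)) (A n - T n k)"
      by (rule inj_on_subset[OF inj_on_to_nat_on[OF A(2)]]) auto
    moreover have "to_nat_on (A n) ` (A n - T n k) \<subseteq> {..<k}" by (auto simp: T_def)
    ultimately show ?thesis by (meson finite_lessThan inj_on_finite)
  qed
  define D where "D n k = - Sup (T n k)" for n k
  have inc: "incseq (D n)" for n
    unfolding D_def by (intro monoI) (simp, rule Sup_subset_mono, auto simp: T_def)
  have dense: "\<exists>k. inf r (D n k) \<noteq> bot" if r: "r \<noteq> bot" for n r
  proof -
    obtain q where q: "q\<le>r" "q \<noteq> bot" "finite {a\<in>A n. inf q a \<noteq> bot}"
      using A(3)[of n] r unfolding null_set_def by meson
    then have "finite (to_nat_on (A n) ` {a\<in>A n. inf q a \<noteq> bot})" by blast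
    then obtain k where k: "\<And>a. a \<in> A n \<Longrightarrow> inf q a \<noteq> bot \<Longrightarrow> to_nat_on (A n) a < k"
      unfolding finite_nat_set_iff_bounded by auto
    have "Sup (T n k) \<le> - q"
    proof (rule Sup_least)
      fix a assume "a \<in> T n k"
      then have "inf q a = bot" using k unfolding T_def by fastforce
      then show "a \<le> - q" by (metis inf.commute inf_shunt)
    qed
    then have "q \<le> D n k" unfolding D_def by (simp add: compl_le_swap1)
    then have "q \<le> inf r (D n k)" using q by simp
    then show ?thesis using q by (metis bot.extremum_uniqueI)
  qed
  obtain f where f: "\<And>b. b \<noteq> bot \<Longrightarrow> \<exists>q\<le>b. q \<noteq> bot \<and> (\<exists>N. \<forall>n\<ge>N. q \<le> D n (f n))"
    using weakly_distributive_diagonal[where D = D, OF assms inc dense] by blast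
  define B where "B = (\<Union>n. T n (f n))"
  have TA: "T n k \<subseteq> A n" for n k by (auto simp: T_def)
  have "null_set B"
    unfolding null_set_def
  proof (intro allI impI)
    fix b :: 'b assume "b \<noteq> bot"
    then obtain q N where q: "q\<le>b" "q \<noteq> bot" "\<forall>n\<ge>N. q \<le> D n (f n)" using f by meson
    \<comment> \<open>Only the first \<open>N\<close> tails can still meet \<open>q\<close>. They
      lie in a finite union of null sets, so shrinking \<open>q\<close> once more suffices.\<close>
    have "null_set (\<Union>(A ` {..<N}))" using A by (intro null_set_Union) auto
    then obtain q' where q': "q'\<le>q" "q' \<noteq> bot" "finite {a\<in>\<Union>(A ` {..<N}). inf q' a \<noteq> bot}"
      using q(2) unfolding null_set_def by meson
    have "n < N" if "a \<in> T n (f n)" "inf q' a \<noteq> bot" for a n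
    proof (rule ccontr)
      assume "\<not> n < N"
      then have "q' \<le> - Sup (T n (f n))" using q q' unfolding D_def by (meson not_less order_trans)
      also have "\<dots> \<le> - a" using that by (simp add: Sup_upper)
      finally show False using that by (simp add: inf_shunt)
    qed
    then have "{a \<in> B. inf q' a \<noteq> bot} \<subseteq> {a\<in>\<Union>(A ` {..<N}). inf q' a \<noteq> bot}"
      using TA unfolding B_def by blast
    then show "\<exists>q\<le>b. q \<noteq> bot \<and> finite {a \<in> B. inf q a \<noteq> bot}"
      using q q' by (meson finite_subset order_trans)
  qed
  moreover have "B \<subseteq> S" "countable B" using A TA unfolding B_def
    by (blast, meson countableI_type countable_UN countable_subset)
  moreover have "finite (A n - B)" for n
    by (rule finite_subset[OF _ finA[of n "f n"]]) (auto simp: B_def)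
  ultimately show "\<exists>B\<in>{A \<in> countable_subsets S. null_set A}. \<forall>n. finite (A n - B)"
    by (auto simp: countable_subsets_def)
qed

section \<open>Uncountable sets in a ccc algebra\<close>

text \<open>Among the antichains whose elements lie below members of \<open>X\<close>, a maximal one
  is countable; choose a member of \<open>X\<close> above each element. A part of some x in
  \<open>X\<close> outside their join would extend the antichain.\<close>

lemma ccc_countable_Sup:
  fixes X :: "'b::{boolean_algebra,complete_lattice} set"
  assumes "ccc TYPE('b)"
  obtains C where "C \<subseteq> X" "countable C" "Sup C = Sup X"
proof -
  define \<A> where "\<A> = {A. ba_antichain A \<and> (\<forall>d\<in>A. \<exists>x\<in>X. d \<le> x)}"
  have "\<exists>M\<in>\<A>. \<forall>A\<in>\<A>. M \<subseteq> A \<longrightarrow> A = M"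
  proof (rule subset_Zorn, intro bexI ballI)
    fix \<C> assume \<C>: "subset.chain \<A> \<C>"
    then have sub: "\<C> \<subseteq> \<A>" and ch: "\<And>A B. A \<in> \<C> \<Longrightarrow> B \<in> \<C> \<Longrightarrow> A \<subseteq> B \<or> B \<subseteq> A"
      by (auto simp: subset_chain_def)
    have "pairwise (\<lambda>a b. inf a b = bot) (\<Union>\<C>)"
      unfolding pairwise_def
    proof (intro ballI impI)
      fix a b assume "a \<in> \<Union>\<C>" "b \<in> \<Union>\<C>" "a \<noteq> b"
      then obtain A where "A \<in> \<C>" "a \<in> A" "b \<in> A" using ch by blast
      then show "inf a b = bot" using sub \<open>a \<noteq> b\<close> unfolding \<A>_def ba_antichain_def pairwise_def by blast
    qed
    then show "\<Union>\<C> \<in> \<A>" using sub unfolding \<A>_def ba_antichain_def by blast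
    fix A assume "A \<in> \<C>" then show "A \<subseteq> \<Union>\<C>" by blast
  qed
  then obtain M where M: "M \<in> \<A>" and max: "\<And>A. A \<in> \<A> \<Longrightarrow> M \<subseteq> A \<Longrightarrow> A = M" by blast
  have "countable M" using M assms by (auto simp: \<A>_def ccc_def)
  obtain g where g: "\<And>d. d \<in> M \<Longrightarrow> g d \<in> X \<and> d \<le> g d" using M unfolding \<A>_def by simp metis
  have "x \<le> Sup (g ` M)" if "x \<in> X" for x
  proof (rule ccontr)
    assume "\<not> x \<le> Sup (g ` M)"
    then have ne: "inf x (- Sup (g ` M)) \<noteq> bot" (is "?d \<noteq> bot") by (simp add: inf_shunt)
    have disj: "inf d ?d = bot" if "d \<in> M" for d
    proof -
      have "d \<le> Sup (g ` M)" using g[OF that] that by (meson SUP_upper2)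
      then show ?thesis by (meson inf_bot_mono inf_compl_bot inf_le2)
    qed
    have "insert ?d M \<in> \<A>"
      using M ne disj that unfolding \<A>_def ba_antichain_def
      by (auto simp: pairwise_insert inf.commute intro: le_infI1)
    then have "?d \<in> M" using max by blast
    then show False using disj ne by fastforce
  qed
  then have "Sup (g ` M) = Sup X"
    using g by (intro antisym Sup_least Sup_subset_mono) (auto simp: Sup_upper)
  then show thesis using that[of "g ` M"] g \<open>countable M\<close> by auto
qed

text \<open>The sets \<open>g (Z n)\<close> are pairwise disjoint and each has join above the
  nonzero \<open>u\<close>. A nonzero q below \<open>u\<close> thus meets an element of each of
  them, infinitely many in all.\<close>

lemma ccc_uncountable_not_null:
  fixes Y :: "'b::{boolean_algebra,complete_lattice} set"
  assumes ccc: "ccc TYPE('b)" and "uncountable Y" "bot \<notin> Y"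
  shows "\<exists>Z\<subseteq>Y. countable Z \<and> \<not> null_set Z"
proof -
  \<comment> \<open>Countably many of the complements already have the full join, so removing one
    countable set \<open>C0\<close> lowers the join of \<open>Y\<close> as far as any countable
    removal can.\<close>
  obtain G where G: "G \<subseteq> (\<lambda>C. - Sup (Y - C)) ` Collect countable" "countable G"
    "Sup G = (SUP C\<in>Collect countable. - Sup (Y - C))"
    using ccc_countable_Sup[OF ccc] by metis
  then obtain \<C> where \<C>: "\<C> \<subseteq> Collect countable" "countable \<C>" "G = (\<lambda>C. - Sup (Y - C)) ` \<C>"
    by (meson countable_subset_image)
  define C0 where "C0 = \<Union>\<C>"
  have cC0: "countable C0" unfolding C0_def using \<C> countable_UN[of \<C> "\<lambda>x. x"] by auto
  \<comment> \<open>The least value of the joins of co-countable subsets of \<open>Y\<close>, attained because of ccc.\<close>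
  define u where "u = Sup (Y - C0)"
  have u: "u \<le> Sup (Y - C)" if "countable C" for C
  proof -
    have "- Sup (Y - C) \<le> Sup G" unfolding G(3) using that by (intro SUP_upper) auto
    also have "\<dots> \<le> - u" unfolding \<C>(3) u_def
    proof (rule SUP_least)
      fix C assume "C \<in> \<C>"
      then show "- Sup (Y - C) \<le> - Sup (Y - C0)"
        by (simp, intro Sup_subset_mono) (auto simp: C0_def)
    qed
    finally show ?thesis by simp
  qed
  have "\<exists>E. E \<subseteq> Y - C \<and> countable E \<and> u \<le> Sup E" if "countable C" for C
    using u[OF that] ccc_countable_Sup[OF ccc, of "Y - C"] by metis
  then obtain g where g: "\<And>C. countable C \<Longrightarrow> g C \<subseteq> Y - C \<and> countable (g C) \<and> u \<le> Sup (g C)"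
    by metis
  define Z where "Z = rec_nat {} (\<lambda>_ C. C \<union> g C)"
  have Z_simps: "Z 0 = {}" "Z (Suc n) = Z n \<union> g (Z n)" for n by (simp_all add: Z_def)
  have cZ: "countable (Z n)" for n by (induction n) (auto simp: Z_simps g)
  have ZY: "Z n \<subseteq> Y" for n
  proof (induction n)
    case (Suc n) then show ?case using g[OF cZ[of n]] by (auto simp: Z_simps)
  qed (simp add: Z_simps)
  have inc: "incseq Z" by (rule incseq_SucI) (simp add: Z_simps)
  have "Y - C0 \<noteq> {}" using assms(2) cC0 by (metis Diff_eq_empty_iff countable_subset)
  then have "u \<noteq> bot" unfolding u_def using assms(3)
    by (metis Diff_iff Sup_upper bot.extremum_uniqueI ex_in_conv)
  have "\<not> null_set (\<Union>n. Z n)"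
  proof
    assume "null_set (\<Union>n. Z n)"
    then obtain q where q: "q \<le> u" "q \<noteq> bot" "finite {a\<in>\<Union>n. Z n. inf q a \<noteq> bot}"
      using \<open>u \<noteq> bot\<close> unfolding null_set_def by meson
    have "\<exists>a\<in>g (Z n). inf q a \<noteq> bot" for n
    proof (rule ccontr)
      assume "\<not> ?thesis"
      then have "Sup (g (Z n)) \<le> - q" by (intro Sup_least) (metis inf.commute inf_shunt)
      then have "q \<le> - q" using g[OF cZ] q(1) by (meson order_trans)
      then show False using q(2) by (metis inf.idem inf_shunt)
    qed
    then obtain a where a: "\<And>n. a n \<in> g (Z n)" "\<And>n. inf q (a n) \<noteq> bot" by metis
    have ne: "a m \<noteq> a n" if "m < n" for m n
    proof -
      have "a m \<in> Z (Suc m)" using a(1) by (simp add: Z_simps)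
      then have "a m \<in> Z n" using incseqD[OF inc, of "Suc m" n] that by auto
      moreover have "a n \<notin> Z n" using a(1)[of n] g[OF cZ[of n]] by auto
      ultimately show ?thesis by metis
    qed
    have "inj a" by (rule injI) (metis ne linorder_neqE_nat)
    moreover have "range a \<subseteq> {a\<in>\<Union>n. Z n. inf q a \<noteq> bot}"
    proof
      fix z assume "z \<in> range a"
      then obtain n where n: "z = a n" by blast
      have "a n \<in> Z (Suc n)" using a(1) by (simp add: Z_simps)
      then show "z \<in> {a\<in>\<Union>n. Z n. inf q a \<noteq> bot}" using a(2)[of n] n by blast
    qed
    ultimately show False using q(3) by (meson finite_subset range_inj_infinite)
  qed
  then show ?thesis using ZY cZ by (intro exI[of _ "\<Union>n. Z n"]) auto
qed

section \<open>Neighbourhoods of zero\<close>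

text \<open>
  By passing to subsequences, a null sequence even lies in a neighbourhood eventually.
\<close>

definition nbhd :: "'b::boolean_algebra set \<Rightarrow> bool" where
  "nbhd U \<longleftrightarrow> (\<forall>x. null_seq x \<longrightarrow> (\<exists>n. x n \<in> U))"

text \<open>Openness of a downward closed set in the sequential order topology. Testing joins
  suffices: if x(n) converges to x, then x(n) lies below the join of x with the null sequence of
  differences x(n) - x.\<close>

definition down_open :: "'b::boolean_algebra set \<Rightarrow> bool" where
  "down_open U \<longleftrightarrow> bot \<in> U \<and> (\<forall>x\<in>U. \<forall>y\<le>x. y \<in> U) \<and>
     (\<forall>x\<in>U. nbhd {v. sup x v \<in> U})"

definition down_interior :: "'b::boolean_algebra set \<Rightarrow> 'b set" where
  "down_interior U = {x. nbhd {v. sup x v \<in> U}}"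

lemma nbhd_mono: "nbhd U \<Longrightarrow> U \<subseteq> V \<Longrightarrow> nbhd V"
  unfolding nbhd_def by blast

lemma nbhd_eventually:
  assumes "nbhd U" "null_seq x" shows "\<exists>N. \<forall>n\<ge>N. x n \<in> U"
proof (rule ccontr)
  assume "\<not> ?thesis"
  then have "infinite {n. x n \<notin> U}"
    unfolding infinite_nat_iff_unbounded_le by blast
  then obtain r :: "nat \<Rightarrow> nat" where r: "strict_mono r" "\<And>n. r n \<in> {n. x n \<notin> U}"
    using infinite_enumerate by blast
  have "\<exists>n. (x \<circ> r) n \<in> U"
    using assms(1) null_seq_subseq[OF assms(2) r(1)] unfolding nbhd_def by blast
  then show False using r(2) by auto
qed

lemma nbhd_Int:
  assumes "nbhd U" "nbhd V" shows "nbhd (U \<inter> V)"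
  unfolding nbhd_def
proof (intro allI impI)
  fix x :: "nat \<Rightarrow> 'a" assume "null_seq x"
  then obtain M N where "\<forall>n\<ge>M. x n \<in> U" "\<forall>n\<ge>N. x n \<in> V" using assms nbhd_eventually by metis
  then have "x (max M N) \<in> U \<inter> V" by auto
  then show "\<exists>n. x n \<in> U \<inter> V" ..
qed

lemma down_openD:
  assumes "down_open U"
  shows "bot \<in> U" "x \<in> U \<Longrightarrow> y \<le> x \<Longrightarrow> y \<in> U" "x \<in> U \<Longrightarrow> nbhd {v. sup x v \<in> U}"
  using assms unfolding down_open_def by blast+

lemma down_open_nbhd: "down_open U \<Longrightarrow> nbhd U"
  using down_openD(3)[of U bot] by (simp add: down_openD(1))

lemma down_open_Int:
  assumes "down_open U" "down_open V" shows "down_open (U \<inter> V)"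
  unfolding down_open_def
proof (intro conjI ballI allI impI)
  fix x assume "x \<in> U \<inter> V"
  then have "nbhd ({v. sup x v \<in> U} \<inter> {v. sup x v \<in> V})"
    using assms by (intro nbhd_Int down_openD(3)) auto
  moreover have "{v. sup x v \<in> U} \<inter> {v. sup x v \<in> V} = {v. sup x v \<in> U \<inter> V}" by blast
  ultimately show "nbhd {v. sup x v \<in> U \<inter> V}" by simp
qed (use assms in \<open>auto dest: down_openD\<close>)

text \<open>Lets an inductive choice continue: what may still be joined to x without leaving
  \<open>U\<close> is again an admissible set to choose from.\<close>

lemma down_open_shift:
  assumes "down_open U" "x \<in> U" shows "down_open {v. sup x v \<in> U}"
  unfolding down_open_def
proof (intro conjI ballI allI impI)
  fix a assume "a \<in> {v. sup x v \<in> U}"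
  then show "nbhd {v. sup a v \<in> {v. sup x v \<in> U}}"
    using down_openD(3)[OF assms(1), of "sup x a"] by (simp add: sup_assoc)
next
  fix a y assume "a \<in> {v. sup x v \<in> U}" "y \<le> a"
  then show "y \<in> {v. sup x v \<in> U}" using down_openD(2)[OF assms(1)]
    by (metis mem_Collect_eq order_refl sup.mono)
qed (use assms in simp)

lemma down_interior_subset:
  assumes "\<And>x y. x \<in> U \<Longrightarrow> y \<le> x \<Longrightarrow> y \<in> U" shows "down_interior U \<subseteq> U"
proof
  fix x assume "x \<in> down_interior U"
  then show "x \<in> U" using null_seq_bot unfolding down_interior_def nbhd_def by fastforce
qed

lemma down_interior_mono: "U \<subseteq> V \<Longrightarrow> down_interior U \<subseteq> down_interior V"
  unfolding down_interior_def by (auto elim!: nbhd_mono)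

text \<open>Taking the interior once is enough because of the diagonal principle: if x joined with
  \<open>v n\<close> leaves the interior for all n, null sequences \<open>w n\<close> witness this,
  and the null sequence of joins of \<open>v n\<close> with \<open>w n (f n)\<close> would take x
  out of \<open>U\<close>.\<close>

lemma down_open_down_interior:
  fixes U :: "'b::{boolean_algebra,complete_lattice} set"
  assumes "weakly_distributive TYPE('b)" "ccc TYPE('b)"
    and nb: "nbhd U" and down: "\<And>x y. x \<in> U \<Longrightarrow> y \<le> x \<Longrightarrow> y \<in> U"
  shows "down_open (down_interior U)"
  unfolding down_open_def
proof (intro conjI ballI allI impI)
  show "bot \<in> down_interior U" using nb by (simp add: down_interior_def)
next
  fix x y assume "x \<in> down_interior U" "y \<le> x"
  have "sup y v \<in> U" if "sup x v \<in> U" for v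
    using down[OF that] \<open>y \<le> x\<close> by (meson order_refl sup.mono)
  then have "{v. sup x v \<in> U} \<subseteq> {v. sup y v \<in> U}" by blast
  with \<open>x \<in> down_interior U\<close> show "y \<in> down_interior U"
    unfolding down_interior_def by (auto elim: nbhd_mono)
next
  fix x assume x: "x \<in> down_interior U"
  show "nbhd {v. sup x v \<in> down_interior U}"
    unfolding nbhd_def
  proof (intro allI impI, rule ccontr)
    fix v :: "nat \<Rightarrow> 'b" assume v: "null_seq v" and "\<not> (\<exists>n. v n \<in> {v. sup x v \<in> down_interior U})"
    then have "\<not> nbhd {w. sup (sup x (v n)) w \<in> U}" for n
      unfolding down_interior_def by blast
    then have "\<exists>w. null_seq w \<and> (\<forall>k. sup (sup x (v n)) (w k) \<notin> U)" for n
      unfolding nbhd_def by simp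
    then obtain w where w: "\<And>n. null_seq (w n)" "\<And>n k. sup (sup x (v n)) (w n k) \<notin> U" by metis
    obtain f where "null_seq (\<lambda>n. w n (f n))" using null_seq_diagonal[where v = w, OF assms(1,2) w(1)] by blast
    then have "null_seq (\<lambda>n. sup (v n) (w n (f n)))" using v null_seq_sup by blast
    moreover have "nbhd {v. sup x v \<in> U}" using x by (simp add: down_interior_def)
    ultimately obtain n where "sup x (sup (v n) (w n (f n))) \<in> U"
      unfolding nbhd_def by blast
    then show False using w(2) by (simp add: sup_assoc)
  qed
qed

section \<open>Continuity of join at zero\<close>

primrec join_seg :: "(nat \<Rightarrow> 'b::boolean_algebra) \<Rightarrow> nat \<Rightarrow> nat \<Rightarrow> 'b" where
  "join_seg x k 0 = bot"
| "join_seg x k (Suc m) = sup (join_seg x k m) (x (k + m))"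

lemma join_seg_ge: "i < m \<Longrightarrow> x (k + i) \<le> join_seg x k m"
  by (induction m) (auto simp: less_Suc_eq intro: le_supI1)

text \<open>If \<open>x\<close> were not null, the diagonal principle would put one nonzero q below
  a finite segment join starting at n for almost all n. Then q would lie in every
  \<open>U n\<close>.\<close>

lemma join_seg_null:
  fixes U :: "nat \<Rightarrow> 'b::{boolean_algebra,complete_lattice} set"
  assumes wd: "weakly_distributive TYPE('b)" "ccc TYPE('b)"
    and op: "\<And>n. down_open (U n)" and dec: "decseq U" and Int: "(\<Inter>n. U n) = {bot}"
    and x: "\<And>k m. join_seg x k m \<in> U k"
  shows "null_seq x"
proof (rule ccontr)
  assume "\<not> null_seq x"
  then obtain b where b: "b \<noteq> bot" "\<And>q N. q \<le> b \<Longrightarrow> q \<noteq> bot \<Longrightarrow> \<exists>n\<ge>N. inf q (x n) \<noteq> bot"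
    unfolding null_seq_def by blast
  \<comment> \<open>Every part of \<open>b\<close> meets infinitely many \<open>x n\<close>, so the tail joins of \<open>x\<close> cover \<open>b\<close>.\<close>
  define D where "D k m = sup (- b) (join_seg x k m)" for k m
  have inc: "incseq (D k)" for k by (rule incseq_SucI) (simp add: D_def le_supI2 sup.coboundedI1 sup_assoc)
  \<comment> \<open>If \<open>r\<close> is not below \<open>b\<close>, the summand
    \<open>- b\<close> meets it at level 0. Otherwise some \<open>x n\<close> with n >= k meets it,
    and this \<open>x n\<close> is in the segment of length n - k + 1.\<close>
  have dense: "\<exists>m. inf r (D k m) \<noteq> bot" if r: "r \<noteq> bot" for r k
  proof (cases "inf r (- b) = bot")
    case True
    then have "r \<le> b" by (simp add: inf_shunt)
    then obtain n where n: "n \<ge> k" "inf r (x n) \<noteq> bot" using b(2) r by blast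
    have "x n \<le> join_seg x k (Suc (n - k))" using join_seg_ge[of "n-k" "Suc (n-k)" x k] n(1) by simp
    then have "x n \<le> D k (Suc (n - k))" unfolding D_def by (rule le_supI2)
    then show ?thesis using n(2) inf_bot_mono order_refl by metis
  next
    case False
    then show ?thesis unfolding D_def by (intro exI[of _ 0]) simp
  qed
  obtain f where f: "\<And>b. b \<noteq> bot \<Longrightarrow> \<exists>q\<le>b. q \<noteq> bot \<and> (\<exists>N. \<forall>n\<ge>N. q \<le> D n (f n))"
    using weakly_distributive_diagonal[where D = D, OF wd inc dense] by blast
  obtain q N where q: "q \<le> b" "q \<noteq> bot" "\<And>n. n \<ge> N \<Longrightarrow> q \<le> D n (f n)"
    using f[OF b(1)] by blast
  have "q \<in> U n" for n
  proof -
    have "q \<le> join_seg x (max n N) (f (max n N))"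
      using q(1) q(3)[of "max n N"] unfolding D_def by (metis inf.orderE max.cobounded2 shunt1)
    then have "q \<in> U (max n N)" using x down_openD(2)[OF op] by blast
    then show ?thesis using decseqD[OF dec, of n "max n N"] by auto
  qed
  then show False using Int q(2) by blast
qed

text \<open>\<open>G\<close> is an arbitrary neighbourhood while \<open>V\<close> is
  \<open>down_open\<close>, hence itself a neighbourhood, so halving can be iterated.\<close>

lemma nbhd_halving:
  fixes U :: "nat \<Rightarrow> 'b::{boolean_algebra,complete_lattice} set"
  assumes wd: "weakly_distributive TYPE('b)" "ccc TYPE('b)"
    and op: "\<And>n. down_open (U n)" and dec: "decseq U" and Int: "(\<Inter>n. U n) = {bot}"
    and G: "nbhd (G :: 'b set)"
  shows "\<exists>V. down_open V \<and> (\<forall>x\<in>V. \<forall>y\<in>V. sup x y \<in> G)"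
proof (rule ccontr)
  assume "\<not> ?thesis"
  then have "\<exists>p. fst p \<in> V \<and> snd p \<in> V \<and> sup (fst p) (snd p) \<notin> G" if "down_open V" for V
    using that by (simp, blast)
  then obtain p where p: "\<And>V. down_open V \<Longrightarrow> fst (p V) \<in> V \<and> snd (p V) \<in> V \<and> sup (fst (p V)) (snd (p V)) \<notin> G"
    by metis
  \<comment> \<open>\<open>V n\<close> collects the elements that may still be joined to all earlier choices.\<close>
  define V where "V = rec_nat (U 0) (\<lambda>n V. U (Suc n) \<inter> ({v. sup (fst (p V)) v \<in> V} \<inter> {v. sup (snd (p V)) v \<in> V}))"
  have V_Suc: "V (Suc n) = U (Suc n) \<inter> ({v. sup (fst (p (V n))) v \<in> V n} \<inter> {v. sup (snd (p (V n))) v \<in> V n})" for n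
    by (simp add: V_def)
  have V0: "V 0 = U 0" by (simp add: V_def)
  have VU: "V n \<subseteq> U n" for n by (cases n) (auto simp: V0 V_Suc)
  have opV: "down_open (V n)" for n
    by (induction n) (auto simp: V0 V_Suc op p intro!: down_open_Int down_open_shift)
  have seg: "join_seg x k m \<in> U k" if "\<And>n v. v \<in> V (Suc n) \<Longrightarrow> sup (x n) v \<in> V n" for x k m
  proof -
    \<comment> \<open>The induction absorbs the last term of the segment into \<open>v\<close>,
      moving back one stage at a time to \<open>V k\<close>; the segment itself is the case of
      \<open>v\<close> being \<open>bot\<close>.\<close>
    have "sup (join_seg x k m) v \<in> V k" if "v \<in> V (k + m)" for v
      using that
    proof (induction m arbitrary: v)
      case (Suc m)
      then have "sup (x (k + m)) v \<in> V (k + m)" using \<open>\<And>n v. v \<in> V (Suc n) \<Longrightarrow> sup (x n) v \<in> V n\<close> by simp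
      from Suc.IH[OF this] show ?case by (simp add: sup_assoc)
    qed simp
    from this[of bot] show ?thesis using down_openD(1)[OF opV] VU by auto
  qed
  have "null_seq (\<lambda>n. fst (p (V n)))" "null_seq (\<lambda>n. snd (p (V n)))"
    by (rule join_seg_null[OF wd op dec Int seg]; simp add: V_Suc)+
  then have "null_seq (\<lambda>n. sup (fst (p (V n))) (snd (p (V n))))" by (rule null_seq_sup)
  then show False using G p opV unfolding nbhd_def by blast
qed

section \<open>Frink's construction of a submeasure\<close>

lemma sum_list_crossing:
  fixes c :: real
  assumes "0 < c" "c \<le> sum_list (map h xs)"
  shows "\<exists>ys x zs. xs = ys @ x # zs \<and> sum_list (map h ys) < c \<and> c \<le> sum_list (map h ys) + h x"
  using assms(2)
proof (induction xs rule: rev_induct)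
  case (snoc a xs)
  show ?case
  proof (cases "c \<le> sum_list (map h xs)")
    case True
    then obtain ys x zs where "xs = ys @ x # zs" "sum_list (map h ys) < c" "c \<le> sum_list (map h ys) + h x"
      using snoc.IH by blast
    then show ?thesis by (intro exI[of _ ys] exI[of _ x] exI[of _ "zs @ [a]"]) simp
  next
    case False
    then show ?thesis using snoc.prems by (intro exI[of _ xs] exI[of _ a] exI[of _ "[]"]) simp
  qed
qed (use assms(1) in simp)

text \<open>Cut at the entry where the partial sums reach \<open>c\<close>; what follows weighs less
  than \<open>c\<close>, since the total is below \<open>2 * c\<close>. That entry may itself weigh
  \<open>c\<close> or more, so it is set apart, which is why triple joins are needed.\<close>

lemma sum_list_split:
  fixes c :: real
  assumes "xs \<noteq> []" and pos: "\<And>x. 0 \<le> h x" and "0 < c" "sum_list (map h xs) < 2 * c"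
  shows "\<exists>ys x zs. xs = ys @ x # zs \<and> sum_list (map h ys) < c \<and> sum_list (map h zs) < c"
proof (cases "c \<le> sum_list (map h xs)")
  case True
  then obtain ys x zs where "xs = ys @ x # zs" "sum_list (map h ys) < c" "c \<le> sum_list (map h ys) + h x"
    using sum_list_crossing[OF \<open>0 < c\<close>] by blast
  then show ?thesis using assms(4) by (intro exI[of _ ys] exI[of _ x] exI[of _ zs]) simp
next
  case False
  obtain x zs where "xs = x # zs" using assms(1) by (cases xs) auto
  then show ?thesis using False pos[of x] \<open>0 < c\<close>
    by (intro exI[of _ "[]"] exI[of _ x] exI[of _ zs]) simp
qed

text \<open>A pair (n, a) stands for an element a of \<open>W n\<close> at cost
  \<open>(1/2)^n\<close>. The index is stored because a may belong to several
  \<open>W n\<close>.\<close>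

definition join_list :: "(nat \<times> 'b::boolean_algebra) list \<Rightarrow> 'b" where
  "join_list ps = foldr (\<lambda>p. sup (snd p)) ps bot"

lemma join_list_simps [simp]:
  "join_list [] = bot" "join_list (p # ps) = sup (snd p) (join_list ps)"
  by (simp_all add: join_list_def)

lemma join_list_append [simp]: "join_list (ps @ qs) = sup (join_list ps) (join_list qs)"
  by (induction ps) (simp_all add: sup_assoc)

text \<open>Split the list into two parts of weight below \<open>(1/2)^Suc n\<close> and a middle
  entry. A single weight below \<open>(1/2)^n\<close> forces an index above n, so all three joins
  lie in \<open>W (Suc n)\<close>.\<close>

lemma join_list_mem:
  fixes W :: "nat \<Rightarrow> 'b::boolean_algebra set"
  assumes bot: "\<And>n. bot \<in> W n"
    and triple: "\<And>n x y z. x \<in> W (Suc n) \<Longrightarrow> y \<in> W (Suc n) \<Longrightarrow> z \<in> W (Suc n) \<Longrightarrow> sup x (sup y z) \<in> W n"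
    and "\<forall>p\<in>set ps. snd p \<in> W (fst p)" "(\<Sum>p\<leftarrow>ps. (1/2)^fst p) < ((1/2)^n :: real)"
  shows "join_list ps \<in> W n"
  using assms(3,4)
proof (induction ps arbitrary: n rule: length_induct)
  case (1 ps)
  have "W (Suc k) \<subseteq> W k" for k using triple[of _ k bot bot] bot by auto
  then have dec: "decseq W" by (rule decseq_SucI)
  show ?case
  proof (cases "ps = []")
    case False
    have "(\<Sum>p\<leftarrow>ps. (1/2)^fst p) < 2 * ((1/2)^Suc n :: real)" using 1 by simp
    from sum_list_split[OF False _ _ this] obtain qs p rs where s: "ps = qs @ p # rs"
      "(\<Sum>p\<leftarrow>qs. (1/2)^fst p) < ((1/2)^Suc n :: real)" "(\<Sum>p\<leftarrow>rs. (1/2)^fst p) < ((1/2)^Suc n :: real)"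
      by auto
    have IH: "join_list qs \<in> W (Suc n)" "join_list rs \<in> W (Suc n)" 
      using 1 s by auto
    have nn: "0 \<le> (\<Sum>p\<leftarrow>qs. (1/2)^fst p :: real)" "0 \<le> (\<Sum>p\<leftarrow>rs. (1/2)^fst p :: real)"
      by (auto intro!: sum_list_nonneg)
    moreover have "(\<Sum>p\<leftarrow>ps. (1/2)^fst p :: real) =
        (\<Sum>p\<leftarrow>qs. (1/2)^fst p) + ((1/2)^fst p + (\<Sum>p\<leftarrow>rs. (1/2)^fst p))"
      using s(1) by simp
    ultimately have "(1/2)^fst p < ((1/2)^n :: real)" using "1.prems"(2) by linarith
    then have "n < fst p" using power_decreasing[of "fst p" n "1/2 :: real"] by (cases "n < fst p") auto
    then have "snd p \<in> W (Suc n)" using "1.prems"(1) s(1) decseqD[OF dec, of "Suc n" "fst p"] by auto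
    then show ?thesis using triple[OF IH(1) _ IH(2)] s(1) by simp
  qed (simp add: bot)
qed

text \<open>The value of a is the infimum of the costs of finite covers of a. Concatenating covers
  gives subadditivity, \<open>W 0 = UNIV\<close> guarantees a cover, and
  \<open>join_list_mem\<close> yields the last property.\<close>

lemma submeasure_of_nbhds:
  fixes W :: "nat \<Rightarrow> 'b::boolean_algebra set"
  assumes W0: "W 0 = UNIV" and bot: "\<And>n. bot \<in> W n"
    and down: "\<And>n x y. x \<in> W n \<Longrightarrow> y \<le> x \<Longrightarrow> y \<in> W n"
    and triple: "\<And>n x y z. x \<in> W (Suc n) \<Longrightarrow> y \<in> W (Suc n) \<Longrightarrow> z \<in> W (Suc n) \<Longrightarrow> sup x (sup y z) \<in> W n"
  obtains \<mu> :: "'b \<Rightarrow> real" where "submeasure \<mu>" "\<And>n a. a \<in> W n \<Longrightarrow> \<mu> a \<le> (1/2)^n"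
    "\<And>n a. \<mu> a < (1/2)^n \<Longrightarrow> a \<in> W n"
proof -
  define wt where "wt ps = (\<Sum>p\<leftarrow>ps. (1/2)^fst p :: real)" for ps :: "(nat \<times> 'b) list"
  define R where "R a = wt ` {ps. (\<forall>p\<in>set ps. snd p \<in> W (fst p)) \<and> a \<le> join_list ps}" for a
  define \<mu> where "\<mu> a = Inf (R a)" for a
  have R_single: "(1/2)^n \<in> R a" if "a \<in> W n" for a n
    unfolding R_def using that by (intro image_eqI[of _ _ "[(n, a)]"]) (auto simp: wt_def)
  have ne: "R a \<noteq> {}" for a using R_single[of a 0] W0 by auto
  have R_nonneg: "0 \<le> s" if "s \<in> R a" for s a
    using that unfolding R_def wt_def by (auto intro!: sum_list_nonneg)
  then have bdd: "bdd_below (R a)" for a by (meson bdd_belowI)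
  have lower: "\<mu> a \<le> s" if "s \<in> R a" for s a unfolding \<mu>_def using that bdd by (rule cInf_lower)
  have nonneg: "0 \<le> \<mu> a" for a unfolding \<mu>_def using ne R_nonneg by (meson cInf_greatest)
  have "0 \<in> R bot" unfolding R_def by (intro image_eqI[of _ _ "[]"]) (auto simp: wt_def)
  then have "\<mu> bot = 0" using lower nonneg by (meson antisym)
  moreover have "\<mu> a \<le> \<mu> b" if "a \<le> b" for a b
    unfolding \<mu>_def by (rule cInf_superset_mono[OF ne bdd]) (use that in \<open>auto simp: R_def intro: order_trans\<close>)
  moreover have "\<mu> (sup a b) \<le> \<mu> a + \<mu> b" for a b
  proof -
    have "\<mu> (sup a b) \<le> s + t" if st: "s \<in> R a" "t \<in> R b" for s t
    proof -
      obtain ps where ps: "s = wt ps" "\<forall>p\<in>set ps. snd p \<in> W (fst p)" "a \<le> join_list ps"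
        using st(1) unfolding R_def by blast
      obtain qs where qs: "t = wt qs" "\<forall>p\<in>set qs. snd p \<in> W (fst p)" "b \<le> join_list qs"
        using st(2) unfolding R_def by blast
      have "s + t \<in> R (sup a b)"
        unfolding R_def using ps qs
        by (intro image_eqI[of _ _ "ps @ qs"]) (auto simp: wt_def intro: le_supI1 le_supI2)
      then show ?thesis by (rule lower)
    qed
    then have "\<mu> (sup a b) - t \<le> \<mu> a" if "t \<in> R b" for t
      unfolding \<mu>_def[of a] using ne that by (intro cInf_greatest) (auto simp: algebra_simps)
    then have "\<mu> (sup a b) - \<mu> a \<le> \<mu> b"
      unfolding \<mu>_def[of b] using ne by (intro cInf_greatest) (auto simp: algebra_simps)
    then show ?thesis by simp
  qed
  ultimately have sub: "submeasure \<mu>" using nonneg by (simp add: submeasure_def)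
  have "a \<in> W n" if small: "\<mu> a < (1/2)^n" for a n
  proof -
    obtain s where "s \<in> R a" "s < (1/2)^n"
      using cInf_lessD[OF ne] small unfolding \<mu>_def by blast
    then obtain ps where "\<forall>p\<in>set ps. snd p \<in> W (fst p)" "a \<le> join_list ps" "wt ps < (1/2)^n"
      unfolding R_def by blast
    then show ?thesis using join_list_mem[of W ps n, OF bot triple] down unfolding wt_def by blast
  qed
  then show thesis using that[OF sub] lower R_single by blast
qed

section \<open>From the dichotomy to neighbourhoods\<close>

text \<open>A null sequence missing this set would have below it a null sequence in
  \<open>X\<close>. The range of the latter is null, hence finite, so a nonzero value recurs
  infinitely often, contradicting nullness.\<close>

lemma nbhd_avoiding:
  fixes X :: "'b::boolean_algebra set"
  assumes "bot \<notin> X" and fin: "\<And>A. countable A \<Longrightarrow> bot \<notin> A \<Longrightarrow> null_set A \<Longrightarrow> finite (X \<inter> A)"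
  shows "nbhd {x. \<forall>y\<le>x. y \<notin> X}"
  unfolding nbhd_def
proof (intro allI impI, rule ccontr)
  fix x :: "nat \<Rightarrow> 'b" assume x: "null_seq x" and "\<not> (\<exists>n. x n \<in> {x. \<forall>y\<le>x. y \<notin> X})"
  then obtain y where y: "\<And>n. y n \<le> x n" "\<And>n. y n \<in> X" by simp metis
  have ny: "null_seq y" using null_seq_mono x y(1) by blast
  have "null_set (range y)"
    unfolding null_set_def
  proof (intro allI impI)
    fix b :: 'b assume "b \<noteq> bot"
    then obtain q N where q: "q \<le> b" "q \<noteq> bot" "\<forall>n\<ge>N. inf q (y n) = bot"
      using ny unfolding null_seq_def by meson
    have "n < N" if "inf q (y n) \<noteq> bot" for n using q(3) that by (meson leI)
    then have "{a \<in> range y. inf q a \<noteq> bot} \<subseteq> y ` {..<N}" by blast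
    then have "finite {a \<in> range y. inf q a \<noteq> bot}" by (meson finite_imageI finite_lessThan finite_subset)
    then show "\<exists>q\<le>b. q \<noteq> bot \<and> finite {a \<in> range y. inf q a \<noteq> bot}" using q by blast
  qed
  moreover have "bot \<notin> range y" using y(2) assms(1) by (metis imageE)
  ultimately have "finite (X \<inter> range y)" by (intro fin) auto
  moreover have "X \<inter> range y = range y" using y(2) by blast
  ultimately have "finite (range y)" by simp
  then obtain m where m: "infinite {n. y n = y m}"
    using pigeonhole_infinite[of UNIV y] by auto
  have "y m \<noteq> bot" using y(2) assms(1) by metis
  then obtain q N where q: "q \<le> y m" "q \<noteq> bot" "\<forall>n\<ge>N. inf q (y n) = bot"
    using ny unfolding null_seq_def by meson
  obtain n where "n \<ge> N" "y n = y m"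
    using m unfolding infinite_nat_iff_unbounded_le by blast
  then show False using q by (metis inf.absorb1)
qed

lemma dichotomy_covering:
  assumes pid: "p_ideal_dichotomy TYPE('b::{boolean_algebra,complete_lattice})"
    and wd: "weakly_distributive TYPE('b)" "ccc TYPE('b)"
  shows "\<exists>X :: nat \<Rightarrow> 'b set. (\<Union>n. X n) = UNIV - {bot} \<and>
    (\<forall>n A. countable A \<longrightarrow> bot \<notin> A \<longrightarrow> null_set A \<longrightarrow> finite (X n \<inter> A))"
\<comment> \<open>The dichotomy speaks of infinite sets only; in a finite algebra a constant
  covering works.\<close>
proof (cases "finite (UNIV - {bot :: 'b})")
  case True
  then show ?thesis by (intro exI[of _ "\<lambda>_. UNIV - {bot}"]) simp
next
  case False
  define S where "S = UNIV - {bot :: 'b}"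
  define \<I> where "\<I> = {A \<in> countable_subsets S. null_set A}"
  have "p_ideal \<I>" unfolding \<I>_def by (rule p_ideal_null_sets[OF wd])
  moreover have "\<I> \<subseteq> countable_subsets S" by (auto simp: \<I>_def)
  moreover have "infinite S" using False by (simp add: S_def)
  ultimately have "(\<exists>Y\<subseteq>S. uncountable Y \<and> countable_subsets Y \<subseteq> \<I>) \<or>
      (\<exists>X :: nat \<Rightarrow> 'b set. (\<Union>n. X n) = S \<and> (\<forall>n. \<forall>I\<in>\<I>. finite (X n \<inter> I)))"
    using pid unfolding p_ideal_dichotomy_def by simp
  then show ?thesis
  proof (elim disjE exE conjE)
    fix Y assume Y: "Y \<subseteq> S" "uncountable Y" "countable_subsets Y \<subseteq> \<I>"
    then obtain Z where "Z \<subseteq> Y" "countable Z" "\<not> null_set Z"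
      using ccc_uncountable_not_null[OF wd(2), of Y] unfolding S_def by blast
    then show ?thesis using Y(3) unfolding \<I>_def countable_subsets_def by blast
  next
    fix X :: "nat \<Rightarrow> 'b set" assume X: "(\<Union>n. X n) = S" "\<forall>n. \<forall>I\<in>\<I>. finite (X n \<inter> I)"
    have "finite (X n \<inter> A)" if "countable A" "bot \<notin> A" "null_set A" for n A
      using X(2) that unfolding \<I>_def countable_subsets_def S_def by blast
    then show ?thesis using X(1) unfolding S_def by blast
  qed
qed

section \<open>Assembly of the Maharam submeasure\<close>

theorem mainTheorem2:
  assumes "p_ideal_dichotomy TYPE('b::{boolean_algebra,complete_lattice})"
    and "weakly_distributive TYPE('b)"
    and "ccc TYPE('b)"
  shows "\<exists>\<mu> :: 'b \<Rightarrow> real. maharam_submeasure \<mu> \<and> strictly_positive \<mu>"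
proof -
  note wd = assms(2,3)
  obtain X :: "nat \<Rightarrow> 'b set" where X: "(\<Union>n. X n) = UNIV - {bot}"
    "\<And>n A. countable A \<Longrightarrow> bot \<notin> A \<Longrightarrow> null_set A \<Longrightarrow> finite (X n \<inter> A)"
    using dichotomy_covering[OF assms] by blast
  \<comment> \<open>Forbidding all parts in \<open>X i\<close> makes \<open>G n\<close> downward
    closed; collecting the indices up to n makes the sequence decrease.\<close>
  define G where "G n = {x. \<forall>y\<le>x. y \<notin> (\<Union>i\<le>n. X i)}" for n
  define U where "U n = down_interior (G n)" for n
  have nbG: "nbhd (G n)" for n
    unfolding G_def
  proof (rule nbhd_avoiding)
    show "bot \<notin> (\<Union>i\<le>n. X i)" using X(1) by auto
    fix A :: "'b set" assume "countable A" "bot \<notin> A" "null_set A"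
    then have "finite (\<Union>i\<le>n. X i \<inter> A)" using X(2) by blast
    then show "finite ((\<Union>i\<le>n. X i) \<inter> A)" by simp
  qed
  have downG: "y \<in> G n" if "x \<in> G n" "y \<le> x" for x y n using that unfolding G_def by (auto dest: order_trans)
  have op: "down_open (U n)" for n
    unfolding U_def by (rule down_open_down_interior[OF wd nbG downG])
  have dec: "decseq U" unfolding U_def
    by (intro decseq_SucI down_interior_mono) (auto simp: G_def)
  have "x = bot" if "\<And>n. x \<in> U n" for x
  proof (rule ccontr)
    assume "x \<noteq> bot"
    then obtain n where "x \<in> X n" using X(1) by blast
    moreover have "x \<in> G n" using that[of n] down_interior_subset[of "G n"] downG unfolding U_def by blast
    ultimately show False unfolding G_def by auto
  qed
  then have Int: "(\<Inter>n. U n) = {bot}" using down_openD(1)[OF op] by blast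
  have step: "\<exists>V. down_open V \<and> V \<subseteq> U n \<and> (\<forall>x\<in>V. \<forall>y\<in>V. \<forall>z\<in>V. sup x (sup y z) \<in> H)"
    if H: "down_open H" for H n
  proof -
    \<comment> \<open>Halving twice handles triple joins: y and z join into \<open>V\<close>, and x
      is in \<open>V\<close> because \<open>V'\<close> contains \<open>bot\<close>.\<close>
    obtain V where V: "down_open V" "\<forall>x\<in>V. \<forall>y\<in>V. sup x y \<in> H"
      using nbhd_halving[OF wd op dec Int down_open_nbhd[OF H]] by blast
    obtain V' where V': "down_open V'" "\<forall>x\<in>V'. \<forall>y\<in>V'. sup x y \<in> V"
      using nbhd_halving[OF wd op dec Int down_open_nbhd[OF V(1)]] by blast
    have "V' \<subseteq> V" using V'(2) down_openD(1)[OF V'(1)] by (metis subsetI sup_bot_right)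
    then show ?thesis using V V' down_open_Int[OF V'(1) op[of n]] by (intro exI[of _ "V' \<inter> U n"]) blast
  qed
  define F where "F n H = (SOME V. down_open V \<and> V \<subseteq> U n \<and>
      (\<forall>x\<in>V. \<forall>y\<in>V. \<forall>z\<in>V. sup x (sup y z) \<in> H))" for n H
  have F: "down_open (F n H) \<and> F n H \<subseteq> U n \<and>
      (\<forall>x\<in>F n H. \<forall>y\<in>F n H. \<forall>z\<in>F n H. sup x (sup y z) \<in> H)" if "down_open H" for n H
    unfolding F_def by (rule someI_ex) (rule step[OF that])
  define W where "W = rec_nat UNIV F"
  have W_simps: "W 0 = UNIV" "W (Suc n) = F n (W n)" for n by (simp_all add: W_def)
  have "down_open (UNIV :: 'b set)" unfolding down_open_def nbhd_def by simp
  then have opW: "down_open (W n)" for n by (induction n) (simp_all add: W_simps F)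
  have WU: "W (Suc n) \<subseteq> U n" for n using F[OF opW] by (simp add: W_simps)
  have triple: "sup x (sup y z) \<in> W n" if "x \<in> W (Suc n)" "y \<in> W (Suc n)" "z \<in> W (Suc n)" for x y z n
    using F[OF opW[of n], of n] that unfolding W_simps by blast
  obtain \<mu> :: "'b \<Rightarrow> real" where \<mu>: "submeasure \<mu>" "\<And>n a. a \<in> W n \<Longrightarrow> \<mu> a \<le> (1/2)^n"
    "\<And>n a. \<mu> a < (1/2)^n \<Longrightarrow> a \<in> W n"
    by (rule submeasure_of_nbhds[of W, OF W_simps(1) down_openD(1,2)[OF opW] triple]) blast+
  have "strictly_positive \<mu>"
    unfolding strictly_positive_def
  proof (intro allI impI)
    fix a assume "\<mu> a = 0"
    then have "a \<in> W (Suc n)" for n by (intro \<mu>(3)) simp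
    then show "a = bot" using WU Int by blast
  qed
  moreover have "(\<lambda>n. \<mu> (a n)) \<longlonglongrightarrow> 0" if a: "decseq a" "(INF n. a n) = bot" for a
  proof -
    have "null_seq a"
      unfolding null_seq_def
    proof (intro allI impI)
      fix b :: 'b assume "b \<noteq> bot"
      \<comment> \<open>Some \<open>a n\<close> fails to contain \<open>b\<close>; the part of
        \<open>b\<close> outside it is disjoint from all later terms.\<close>
      then obtain n where "\<not> b \<le> a n" using a(2) by (metis INF_greatest bot.extremum_uniqueI)
      then have "inf b (- a n) \<noteq> bot" by (simp add: inf_shunt)
      moreover have "inf (inf b (- a n)) (a m) = bot" if "m \<ge> n" for m
        using decseqD[OF a(1) that] by (metis inf_bot_mono inf_compl_bot inf.commute inf_le2)
      ultimately show "\<exists>q\<le>b. q \<noteq> bot \<and> (\<exists>N. \<forall>n\<ge>N. inf q (a n) = bot)"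
        by (intro exI[of _ "inf b (- a n)"]) auto
    qed
    show ?thesis
    proof (rule LIMSEQ_I)
      fix r :: real assume "0 < r"
      then obtain k where k: "(1/2)^k < r" using real_arch_pow_inv[of r "1/2"] by auto
      obtain N where "\<forall>n\<ge>N. a n \<in> W k"
        using nbhd_eventually[OF down_open_nbhd[OF opW] \<open>null_seq a\<close>] by blast
      then have "\<forall>n\<ge>N. norm (\<mu> (a n) - 0) < r"
        using \<mu>(1,2) k unfolding submeasure_def by (auto intro: le_less_trans)
      then show "\<exists>N. \<forall>n\<ge>N. norm (\<mu> (a n) - 0) < r" ..
    qed
  qed
  ultimately show ?thesis using \<mu>(1) unfolding maharam_submeasure_def by blast
qed

end
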